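(* Let $n \geq 3$ and let $\mathbf{A} = [a_{ij}]_{i,j=1,\ldots,n}$ be a simple perturbed pairwise comparison matrix. Then the principal right eigenvector $\mathbf{w}^{EM}$ of $\mathbf{A}$ is efficient (with respect to $\mathbf{A}$).
   Context: Let $n \geq 3$. A pairwise comparison matrix (PCM) of size $n \times n$ is a real matrix $\mathbf{A} = [a_{ij}]_{i,j=1,\ldots,n}$ with $a_{ij} > 0$ and $a_{ji} = 1/a_{ij}$ for all $i,j = 1,\ldots,n$ (in particular $a_{ii} = 1$). The PCM $\mathbf{A}$ is called consistent if $a_{ik} a_{kj} = a_{ij}$ for all $i,j,k = 1,\ldots,n$. A PCM $\mathbf{A}$ is called simple perturbed if it differs from a consistent PCM in exactly one element and its reciprocal; that is, there exist a consistent PCM $\mathbf{B} = [b_{ij}]$ of size $n\times n$, indices $k \neq \ell$ and a real number $\delta > 0$, $\delta \neq 1$, such that $a_{k\ell} = \delta\, b_{k\ell}$, $a_{\ell k} = \frac{1}{\delta} b_{\ell k}$, and $a_{ij} = b_{ij}$ for all other pairs $(i,j)$. The principal right eigenvector $\mathbf{w}^{EM}$ of a PCM $\mathbf{A}$ is the positive vector satisfying $\mathbf{A}\mathbf{w}^{EM} = \lambda_{\max} \mathbf{w}^{EM}$, where $\lambda_{\max}$ is the Perron (maximal) eigenvalue of $\mathbf{A}$; it is unique up to multiplication by a positive scalar. A vector $\mathbf{w} = (w_1,\ldots,w_n)^{\top}$ with all $w_i > 0$ (a positive weight vector) is called efficient (with respect to $\mathbf{A}$) if there is no positive vector $\mathbf{w}'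 = (w_1',\ldots,w_n')^{\top}$ such that $\left| a_{ij} - \frac{w_i'}{w_j'} \right| \leq \left| a_{ij} - \frac{w_i}{w_j} \right|$ for all $1 \leq i,j \leq n$ and $\left| a_{k\ell} - \frac{w_k'}{w_\ell'} \right| < \left| a_{k\ell} - \frac{w_k}{w_\ell} \right|$ for some $1 \leq k,\ell \leq n$. *)

theory Defs
  imports "Jordan_Normal_Form.Spectral_Radius"
begin

text \<open>Rows and columns are indexed by \<open>0, \<dots>, n - 1\<close>.\<close>

definition pcm :: "nat \<Rightarrow> real mat \<Rightarrow> bool" where
  "pcm n A \<longleftrightarrow> A \<in> carrier_mat n n \<and>
     (\<forall>i<n. \<forall>j<n. A $$ (i, j) > 0 \<and> A $$ (j, i) = 1 / A $$ (i, j))"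

definition consistent_pcm :: "nat \<Rightarrow> real mat \<Rightarrow> bool" where
  "consistent_pcm n A \<longleftrightarrow> pcm n A \<and>
     (\<forall>i<n. \<forall>j<n. \<forall>k<n. A $$ (i, k) * A $$ (k, j) = A $$ (i, j))"

definition simple_perturbed_pcm :: "nat \<Rightarrow> real mat \<Rightarrow> bool" where
  "simple_perturbed_pcm n A \<longleftrightarrow> pcm n A \<and>
     (\<exists>B k l. \<exists>\<delta>::real. consistent_pcm n B \<and> k < n \<and> l < n \<and> k \<noteq> l \<and> \<delta> > 0 \<and> \<delta> \<noteq> 1 \<and>
        A $$ (k, l) = \<delta> * B $$ (k, l) \<and>
        A $$ (l, k) = (1 / \<delta>) * B $$ (l, k) \<and>
        (\<forall>i<n. \<forall>j<n. (i, j) \<noteq> (k, l) \<and> (i, j) \<noteq> (l, k) \<longrightarrow> A $$ (i, j) = B $$ (i, j)))"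

definition positive_weight_vec :: "nat \<Rightarrow> real vec \<Rightarrow> bool" where
  "positive_weight_vec n w \<longleftrightarrow> w \<in> carrier_vec n \<and> (\<forall>i<n. w $ i > 0)"

text \<open>For a matrix with positive entries the Perron eigenvalue is the spectral radius, taken over
  all complex eigenvalues.\<close>

definition perron_eigenvalue :: "real mat \<Rightarrow> real" where
  "perron_eigenvalue A = spectral_radius (map_mat complex_of_real A)"

text \<open>The principal eigenvector is determined only up to a positive factor, hence a predicate.\<close>

definition principal_right_eigenvector :: "nat \<Rightarrow> real mat \<Rightarrow> real vec \<Rightarrow> bool" where
  "principal_right_eigenvector n A w \<longleftrightarrow>
     positive_weight_vec n w \<and> eigenvector A w (perron_eigenvalue A)"

definition efficient :: "nat \<Rightarrow> real mat \<Rightarrow> real vec \<Rightarrow> bool" where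
  "efficient n A w \<longleftrightarrow> positive_weight_vec n w \<and>
     \<not> (\<exists>w'. positive_weight_vec n w' \<and>
          (\<forall>i<n. \<forall>j<n. \<bar>A $$ (i, j) - w' $ i / w' $ j\<bar> \<le> \<bar>A $$ (i, j) - w $ i / w $ j\<bar>) \<and>
          (\<exists>k<n. \<exists>l<n. \<bar>A $$ (k, l) - w' $ k / w' $ l\<bar> < \<bar>A $$ (k, l) - w $ k / w $ l\<bar>))"

end

theory Submission
  imports Defs
begin

text \<open>Why it is true. Draw an arrow from \<open>i\<close> to \<open>j\<close> whenever \<open>w\<^sub>i / w\<^sub>j\<close> is at least the entry
  \<open>a\<^sub>i\<^sub>j\<close>. A vector that dominates \<open>w\<close> cannot increase a ratio that is already too large, so along
  arrows the quotients \<open>w'\<^sub>i / w\<^sub>i\<close> are nondecreasing. If every vertex can be reached from every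
  other, these quotients are therefore constant, \<open>w'\<close> is a multiple of \<open>w\<close>, and nothing has improved
  strictly (\<open>efficient_if_strongly_connected\<close>).

  For a simple perturbed matrix, write the underlying consistent matrix as \<open>v\<^sub>i / v\<^sub>j\<close> and put
  \<open>u\<^sub>i = w\<^sub>i / v\<^sub>i\<close>. Swapping the two perturbed indices if necessary, the factor \<open>\<delta>\<close> at position
  \<open>(k, l)\<close> exceeds 1. The unperturbed rows of the eigenvalue equation say that \<open>u\<^sub>i\<close> has one and the
  same value for all \<open>i \<notin> {k, l}\<close>; row \<open>k\<close> says that \<open>u\<^sub>k\<close> is larger and row \<open>l\<close> that \<open>u\<^sub>l\<close> is
  smaller. This gives arrows \<open>k \<rightarrow> i \<rightarrow> l\<close>. Combining rows \<open>k\<close> and \<open>l\<close> yields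
  \<open>u\<^sub>k / u\<^sub>l \<le> \<delta>\<close>, which is the arrow \<open>l \<rightarrow> k\<close> that closes the cycle.\<close>

definition overestimates :: "nat \<Rightarrow> real mat \<Rightarrow> real vec \<Rightarrow> (nat \<times> nat) set" where
  "overestimates n A w = {(i, j). i < n \<and> j < n \<and> A $$ (i, j) \<le> w $ i / w $ j}"

text \<open>On a closed walk a quantity that never decreases is constant; here the quantity is the
  factor by which a dominating vector rescales each weight.\<close>

lemma efficient_if_strongly_connected:
  assumes w: "positive_weight_vec n w"
    and conn: "\<And>i j. i < n \<Longrightarrow> j < n \<Longrightarrow> (i, j) \<in> (overestimates n A w)\<^sup>*"
  shows "efficient n A w"
  unfolding efficient_def
proof (intro conjI notI w)
  assume "\<exists>w'. positive_weight_vec n w' \<and>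
      (\<forall>i<n. \<forall>j<n. \<bar>A $$ (i, j) - w' $ i / w' $ j\<bar> \<le> \<bar>A $$ (i, j) - w $ i / w $ j\<bar>) \<and>
      (\<exists>k<n. \<exists>l<n. \<bar>A $$ (k, l) - w' $ k / w' $ l\<bar> < \<bar>A $$ (k, l) - w $ k / w $ l\<bar>)"
  then obtain w' k l where w': "positive_weight_vec n w'"
    and le: "\<And>i j. i < n \<Longrightarrow> j < n \<Longrightarrow>
      \<bar>A $$ (i, j) - w' $ i / w' $ j\<bar> \<le> \<bar>A $$ (i, j) - w $ i / w $ j\<bar>"
    and kl: "k < n" "l < n"
    and less: "\<bar>A $$ (k, l) - w' $ k / w' $ l\<bar> < \<bar>A $$ (k, l) - w $ k / w $ l\<bar>"
    by blast
  have pos: "w $ i > 0" "w' $ i > 0" if "i < n" for i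
    using w w' that by (auto simp: positive_weight_vec_def)
  have step: "w' $ i / w $ i \<le> w' $ j / w $ j" if "(i, j) \<in> overestimates n A w" for i j
  proof -
    from that have ij: "i < n" "j < n" and "A $$ (i, j) \<le> w $ i / w $ j"
      by (auto simp: overestimates_def)
    with le[OF ij] have "w' $ i / w' $ j \<le> w $ i / w $ j"
      by linarith
    then show ?thesis
      using pos[OF ij(1)] pos[OF ij(2)] by (simp add: field_simps)
  qed
  have mono: "w' $ i / w $ i \<le> w' $ j / w $ j" if "(i, j) \<in> (overestimates n A w)\<^sup>*" for i j
    using that by (induction rule: rtrancl_induct) (auto intro: order_trans step)
  have "w' $ k / w $ k = w' $ l / w $ l"
    using mono conn kl by (meson antisym)
  then have "w' $ k / w' $ l = w $ k / w $ l"
    using pos[OF kl(1)] pos[OF kl(2)] by (simp add: field_simps)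
  with less show False
    by simp
qed

lemma consistent_pcm_as_ratios:
  assumes "consistent_pcm n B" and "n > 0"
  obtains v where "\<And>i. i < n \<Longrightarrow> v i > 0"
    and "\<And>i j. i < n \<Longrightarrow> j < n \<Longrightarrow> B $$ (i, j) = v i / v j"
proof
  have p: "pcm n B" using assms(1) by (simp add: consistent_pcm_def)
  show "B $$ (i, 0) > 0" if "i < n" for i
    using p that assms(2) unfolding pcm_def by blast
  show "B $$ (i, j) = B $$ (i, 0) / B $$ (j, 0)" if "i < n" "j < n" for i j
  proof -
    have "B $$ (i, j) = B $$ (i, 0) * B $$ (0, j)"
      using assms that by (simp add: consistent_pcm_def)
    also have "B $$ (0, j) = 1 / B $$ (j, 0)"
      using p assms(2) that(2) unfolding pcm_def by blast
    finally show ?thesis by simp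
  qed
qed

lemma eigenvector_row:
  assumes "A \<in> carrier_mat n n" and "eigenvector A w \<mu>" and "i < n"
  shows "(\<Sum>j<n. A $$ (i, j) * w $ j) = \<mu> * w $ i"
proof -
  have dim: "dim_vec w = n" and eq: "A *\<^sub>v w = \<mu> \<cdot>\<^sub>v w"
    using assms by (auto simp: eigenvector_def)
  have "(A *\<^sub>v w) $ i = (\<Sum>j<n. A $$ (i, j) * w $ j)"
    using assms(1,3) dim by (simp add: scalar_prod_def atLeast0LessThan)
  with eq assms(3) dim show ?thesis by simp
qed

text \<open>With \<open>u\<^sub>i = w\<^sub>i / v\<^sub>i\<close> and \<open>S = \<Sum> u\<^sub>i\<close>, the rows of the eigenvalue equation read
  \<open>\<mu> u\<^sub>i = S\<close> for \<open>i \<notin> {k, l}\<close>, \<open>\<mu> u\<^sub>k = S + (\<delta> - 1) u\<^sub>l\<close> and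
  \<open>\<mu> u\<^sub>l = S - (1 - 1 / \<delta>) u\<^sub>k\<close>. All arrows of the cycle \<open>k \<rightarrow> i \<rightarrow> l \<rightarrow> k\<close> are read off from
  these; the last one uses \<open>\<mu> (u\<^sub>k - \<delta> u\<^sub>l) = (\<delta> - 1) (u\<^sub>k + u\<^sub>l - S)\<close> and \<open>u\<^sub>k + u\<^sub>l \<le> S\<close>. A third
  index is needed to pass from \<open>k\<close> to \<open>l\<close>.\<close>

lemma efficient_of_perturbed_ratios:
  fixes v :: "nat \<Rightarrow> real"
  assumes n: "n \<ge> 3" and kl: "k < n" "l < n" "k \<noteq> l" and \<delta>: "\<delta> > 1"
    and v: "\<And>i. i < n \<Longrightarrow> v i > 0"
    and Akl: "A $$ (k, l) = \<delta> * (v k / v l)"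
    and Alk: "A $$ (l, k) = (1 / \<delta>) * (v l / v k)"
    and A: "\<And>i j. i < n \<Longrightarrow> j < n \<Longrightarrow> (i, j) \<noteq> (k, l) \<Longrightarrow> (i, j) \<noteq> (l, k) \<Longrightarrow>
      A $$ (i, j) = v i / v j"
    and w: "positive_weight_vec n w"
    and eig: "\<And>i. i < n \<Longrightarrow> (\<Sum>j<n. A $$ (i, j) * w $ j) = \<mu> * w $ i"
  shows "efficient n A w"
proof -
  define u where "u i = w $ i / v i" for i
  define S where "S = (\<Sum>j<n. u j)"
  have wpos: "w $ i > 0" if "i < n" for i
    using w that by (auto simp: positive_weight_vec_def)
  have u: "u i > 0" if "i < n" for i
    using wpos v that by (simp add: u_def)
  have S: "S > 0"
    unfolding S_def using u n by (intro sum_pos) (auto simp: lessThan_empty_iff)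
  have sum_two: "u k + u l \<le> S"
  proof -
    have "sum u {k, l} \<le> S"
      unfolding S_def using kl u by (intro sum_mono2) (auto intro: less_imp_le)
    then show ?thesis using kl by simp
  qed

  have v_nonzero: "v i \<noteq> 0" if "i < n" for i
    using v[OF that] by simp
  have row: "\<mu> * u i = (\<Sum>j<n. A $$ (i, j) * (v j / v i) * u j)" if "i < n" for i
  proof -
    have "\<mu> * u i = (\<Sum>j<n. A $$ (i, j) * w $ j) / v i"
      using eig[OF that] by (simp add: u_def)
    also have "\<dots> = (\<Sum>j<n. A $$ (i, j) * (v j / v i) * u j)"
      unfolding sum_divide_distrib using v_nonzero that
      by (intro sum.cong) (auto simp: u_def)
    finally show ?thesis .
  qed
  have row_perturbed: "\<mu> * u i = S + (c - 1) * u m"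
    if "i < n" "m < n" "A $$ (i, m) = c * (v i / v m)"
      and *: "\<And>j. j < n \<Longrightarrow> j \<noteq> m \<Longrightarrow> A $$ (i, j) = v i / v j" for i m c
  proof -
    have "\<mu> * u i = (\<Sum>j<n. u j + (if j = m then (c - 1) * u m else 0))"
      unfolding row[OF that(1)]
    proof (rule sum.cong[OF refl])
      fix j assume "j \<in> {..<n}"
      then have j: "j < n" by simp
      show "A $$ (i, j) * (v j / v i) * u j = u j + (if j = m then (c - 1) * u m else 0)"
        using *[OF j] that(3) v_nonzero[OF j] v_nonzero[OF that(1)]
        by (cases "j = m") (simp_all add: field_simps)
    qed
    also have "\<dots> = S + (c - 1) * u m"
      using that(2) by (simp add: sum.distrib S_def)
    finally show ?thesis .
  qed
  have row_k: "\<mu> * u k = S + (\<delta> - 1) * u l"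
    using kl Akl A by (intro row_perturbed) auto
  have row_l: "\<mu> * u l = S + (1 / \<delta> - 1) * u k"
    using kl Alk A by (intro row_perturbed) auto
  have row_other: "\<mu> * u i = S" if "i < n" "i \<noteq> k" "i \<noteq> l" for i
    \<comment> \<open>an unperturbed row is perturbed by the factor 1, at any position\<close>
    using row_perturbed[of i k 1] that kl A by auto

  have \<mu>: "\<mu> > 0"
  proof -
    have "\<mu> * u k > 0"
      using row_k S u[OF kl(2)] \<delta> by (simp add: add_pos_pos)
    then show ?thesis
      using u[OF kl(1)] by (simp add: zero_less_mult_iff)
  qed
  have u_le: "u i \<le> u j" if "\<mu> * u i \<le> \<mu> * u j" for i j
    using that \<mu> by simp

  have arrow: "(i, j) \<in> overestimates n A w"
    if "i < n" "j < n" "A $$ (i, j) = c * (v i / v j)" "c * u j \<le> u i" for i j c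
  proof -
    have "w $ i / w $ j = (u i / u j) * (v i / v j)"
      using v[OF that(1)] v[OF that(2)] wpos[OF that(2)] by (simp add: u_def field_simps)
    moreover have "c \<le> u i / u j"
      using that(4) u[OF that(2)] by (simp add: pos_le_divide_eq)
    then have "c * (v i / v j) \<le> (u i / u j) * (v i / v j)"
      using v[OF that(1)] v[OF that(2)] by (intro mult_right_mono) auto
    ultimately show ?thesis
      using that(1-3) by (simp only: overestimates_def mem_Collect_eq case_prod_conv)
  qed
  have k_to: "(k, i) \<in> overestimates n A w" if "i < n" "i \<noteq> k" "i \<noteq> l" for i
  proof (rule arrow[of _ _ 1])
    show "1 * u i \<le> u k"
      using u_le[of i k] row_other[OF that] row_k u[OF kl(2)] \<delta> by simp
  qed (use that kl A in auto)
  have to_l: "(i, l) \<in> overestimates n A w" if "i < n" "i \<noteq> k" "i \<noteq> l" for i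
  proof (rule arrow[of _ _ 1])
    have "(1 / \<delta> - 1) * u k \<le> 0"
      using u[OF kl(1)] \<delta> by (intro mult_nonpos_nonneg) auto
    then show "1 * u l \<le> u i"
      using u_le[of l i] row_other[OF that] row_l by simp
  qed (use that kl A in auto)
  have l_to_k: "(l, k) \<in> overestimates n A w"
  proof (rule arrow[OF kl(2,1) Alk])
    have "\<mu> * (\<delta> * u l) = \<delta> * (\<mu> * u l)" by simp
    also have "\<dots> = \<delta> * S + u k - \<delta> * u k"
      unfolding row_l using \<delta> by (simp add: field_simps)
    also have "\<dots> = \<mu> * u k + (\<delta> - 1) * (S - u k - u l)"
      unfolding row_k by (simp add: algebra_simps)
    finally have "\<mu> * u k \<le> \<mu> * (\<delta> * u l)"
      using sum_two \<delta> by simp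
    then have "u k \<le> \<delta> * u l" using \<mu> by simp
    then show "1 / \<delta> * u k \<le> u l"
      using \<delta> by (simp add: field_simps)
  qed

  obtain m where m: "m < n" "m \<noteq> k" "m \<noteq> l"
  proof -
    have "card {k, l} < card {..<n}" using n kl by simp
    then have "\<not> {..<n} \<subseteq> {k, l}"
      by (metis card_mono finite.emptyI finite.insertI not_less)
    then show ?thesis using that by blast
  qed
  have from_k: "(k, i) \<in> (overestimates n A w)\<^sup>*" if "i < n" for i
    using k_to[of i] k_to[OF m] to_l[OF m] that
    by (cases "i = k"; cases "i = l") (auto intro: rtrancl_trans)
  have to_k: "(i, k) \<in> (overestimates n A w)\<^sup>*" if "i < n" for i
    using to_l[of i] l_to_k that
    by (cases "i = k"; cases "i = l") (auto intro: rtrancl_trans)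
  show ?thesis
    by (rule efficient_if_strongly_connected[OF w]) (rule rtrancl_trans[OF to_k from_k])
qed

theorem theorem2:
  fixes n :: nat and A :: "real mat" and w :: "real vec"
  assumes "n \<ge> 3"
    and "simple_perturbed_pcm n A"
    and "principal_right_eigenvector n A w"
  shows "efficient n A w"
proof -
  from assms(2) have "pcm n A"
    by (simp only: simple_perturbed_pcm_def)
  then have carrier: "A \<in> carrier_mat n n"
    by (simp only: pcm_def)
  from assms(2) obtain B k l \<delta> where B: "consistent_pcm n B" and kl: "k < n" "l < n" "k \<noteq> l"
    and \<delta>: "\<delta> > 0" "\<delta> \<noteq> 1"
    and Akl: "A $$ (k, l) = \<delta> * B $$ (k, l)"
    and Alk: "A $$ (l, k) = (1 / \<delta>) * B $$ (l, k)"
    and A: "\<And>i j. i < n \<Longrightarrow> j < n \<Longrightarrow> (i, j) \<noteq> (k, l) \<Longrightarrow> (i, j) \<noteq> (l, k) \<Longrightarrow>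
      A $$ (i, j) = B $$ (i, j)"
    unfolding simple_perturbed_pcm_def by blast
  have w: "positive_weight_vec n w" and "eigenvector A w (perron_eigenvalue A)"
    using assms(3) by (simp_all add: principal_right_eigenvector_def)
  note eig = eigenvector_row[OF carrier this(2)]
  obtain v where v: "\<And>i. i < n \<Longrightarrow> v i > 0"
    and Bv: "\<And>i j. i < n \<Longrightarrow> j < n \<Longrightarrow> B $$ (i, j) = v i / v j"
    using consistent_pcm_as_ratios[OF B] assms(1) by auto
  show ?thesis
  proof (cases "\<delta> > 1")
    case True
    show ?thesis
      by (rule efficient_of_perturbed_ratios[OF assms(1) kl True v _ _ _ w eig])
        (use Akl Alk A Bv kl in auto)
  next
    case False
    \<comment> \<open>the roles of \<open>k\<close> and \<open>l\<close> are exchanged, which turns \<open>\<delta>\<close> into \<open>1 / \<delta>\<close>\<close>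
    with \<delta> have "1 / \<delta> > 1" by simp
    show ?thesis
      by (rule efficient_of_perturbed_ratios[OF assms(1) kl(2,1) kl(3)[symmetric] \<open>1 / \<delta> > 1\<close> v _ _ _ w eig])
        (use Akl Alk A Bv kl in auto)
  qed
qed

end
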